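(* For every integer $n\ge 1$, the geometric polynomials satisfy the recurrence relation $$F_{n}(x)=x\sum_{k=0}^{n-1}\binom{n}{k}F_{k}(x).$$
   Context: For integers $n,k\ge 0$, ${n\brace k}$ denotes the Stirling number of the second kind, defined by $\sum_{n=0}^{\infty}{n\brace k}\frac{x^n}{n!}=\frac{(e^x-1)^k}{k!}$. The $n$-th geometric (Fubini) polynomial is $F_n(x)=\sum_{k=0}^{n}{n\brace k}k!\,x^k$ (so $F_0(x)=1$, $F_1(x)=x$, $F_2(x)=x+2x^2$). *)

theory Defs
  imports
    "HOL-Combinatorics.Stirling"
    "HOL-Computational_Algebra.Polynomial"
    "HOL-Computational_Algebra.Formal_Power_Series"
begin

(* The library defines the Stirling numbers of the second kind by their recurrence; the next lemma
   shows that they agree with the definition by the exponential generating function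
   (exp x - 1)^k / k!. *)

lemma Stirling_egf:
  fixes k :: nat
  shows "Abs_fps (\<lambda>n. of_nat (Stirling n k) / fact n) =
    fps_const (1 / fact k) * (fps_exp (1 :: 'a :: field_char_0) - 1) ^ k"
proof -
  define G :: "nat \<Rightarrow> 'a fps"
    where "G k = fps_const (1 / fact k) * (fps_exp 1 - 1) ^ k" for k
  have deriv: "fps_deriv (G (Suc j)) = of_nat (Suc j) * G (Suc j) + G j" for j
  proof -
    have c: "fps_const (1 / fact (Suc j)) * of_nat (Suc j) = fps_const (1 / fact j :: 'a)"
      by (simp add: fps_of_nat [symmetric] fps_const_mult del: of_nat_Suc)
    have "fps_deriv (G (Suc j)) =
        (fps_const (1 / fact (Suc j)) * of_nat (Suc j)) * fps_exp 1 * (fps_exp 1 - 1) ^ j"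
      by (simp add: G_def fps_deriv_power' mult_ac del: of_nat_Suc fact_Suc power_Suc)
    also have "\<dots> = (fps_const (1 / fact (Suc j)) * of_nat (Suc j)) * (fps_exp 1 - 1) ^ Suc j
        + (fps_const (1 / fact (Suc j)) * of_nat (Suc j)) * (fps_exp 1 - 1) ^ j"
      by (simp add: algebra_simps del: of_nat_Suc fact_Suc)
    also have "\<dots> = of_nat (Suc j) * G (Suc j) + G j"
      by (simp only: G_def c [symmetric]) (simp only: c G_def mult_ac)
    finally show ?thesis .
  qed
  have nth: "fps_nth (G k) n = of_nat (Stirling n k) / fact n" for n k
  proof (induction n arbitrary: k)
    case 0
    show ?case by (cases k) (simp_all add: G_def fps_nth_power_0)
  next
    case (Suc n)
    show ?case
    proof (cases k)
      case 0
      then show ?thesis by (simp add: G_def)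
    next
      case (Suc j)
      have "of_nat (Suc n) * fps_nth (G (Suc j)) (Suc n) = fps_nth (fps_deriv (G (Suc j))) n"
        by simp
      also have "\<dots> = of_nat (Suc j) * fps_nth (G (Suc j)) n + fps_nth (G j) n"
        unfolding deriv by (simp add: fps_of_nat [symmetric] del: of_nat_Suc)
      also have "\<dots> = of_nat (Stirling (Suc n) (Suc j)) / fact n"
        by (simp only: Suc.IH) (simp add: field_simps)
      finally show ?thesis
        using Suc by (simp add: field_simps del: of_nat_Suc Stirling.simps)
    qed
  qed
  show ?thesis
    by (rule fps_ext) (simp add: nth [symmetric] G_def)
qed

definition geometric_poly :: "nat \<Rightarrow> 'a :: comm_ring_1 poly" where
  "geometric_poly n = (\<Sum>k\<le>n. monom (of_nat (Stirling n k * fact k)) k)"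

lemma geometric_poly_small:
  "geometric_poly 0 = 1"
  "geometric_poly 1 = [:0, 1:]"
  "geometric_poly 2 = [:0, 1, 2:]"
  by (simp_all add: geometric_poly_def numeral_2_eq_2 monom_Suc monom_0 one_pCons)

end

theory Submission
  imports Defs
begin

text \<open>
  Comparing coefficients of \<open>x\<^sup>j\<^sup>+\<^sup>1\<close>, the claim is
  \<open>(j + 1) S(n, j + 1) = \<Sum>k<n. (n choose k) S(k, j)\<close>. This is the vertical recurrence
  \<open>S(n + 1, j + 1) = \<Sum>k\<le>n. (n choose k) S(k, j)\<close> with the term \<open>k = n\<close> removed, because
  \<open>S(n + 1, j + 1) = (j + 1) S(n, j + 1) + S(n, j)\<close>.
\<close>

text \<open>Pascal's rule, summed against \<open>f\<close>; it reduces row \<open>Suc n\<close> to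
  row \<open>n\<close>, where the induction hypothesis below applies.\<close>

lemma sum_choose_Suc:
  fixes f :: "nat \<Rightarrow> nat"
  shows "(\<Sum>k\<le>Suc n. (Suc n choose k) * f k) = (\<Sum>k\<le>n. (n choose k) * (f k + f (Suc k)))"
proof -
  have "(\<Sum>k\<le>Suc n. (Suc n choose k) * f k)
      = f 0 + (\<Sum>k\<le>n. (n choose Suc k) * f (Suc k)) + (\<Sum>k\<le>n. (n choose k) * f (Suc k))"
    by (subst sum.atMost_Suc_shift) (simp add: algebra_simps sum.distrib)
  also have "f 0 + (\<Sum>k\<le>n. (n choose Suc k) * f (Suc k)) = (\<Sum>k\<le>Suc n. (n choose k) * f k)"
    by (subst sum.atMost_Suc_shift) simp
  finally show ?thesis
    by (simp add: algebra_simps sum.distrib)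
qed

text \<open>Combinatorially, \<open>k\<close> counts the elements outside the block of one
  distinguished element.\<close>

lemma Stirling_vertical_recurrence:
  "Stirling (Suc n) (Suc j) = (\<Sum>k\<le>n. (n choose k) * Stirling k j)"
proof (induction n arbitrary: j)
  case 0
  show ?case by (cases j) simp_all
next
  case (Suc n)
  have "(\<Sum>k\<le>Suc n. (Suc n choose k) * Stirling k j)
      = Stirling (Suc n) (Suc j) + (\<Sum>k\<le>n. (n choose k) * Stirling (Suc k) j)"
    by (simp only: sum_choose_Suc Suc.IH distrib_left sum.distrib)
  also have "(\<Sum>k\<le>n. (n choose k) * Stirling (Suc k) j)
      = j * Stirling (Suc n) (Suc j) + Stirling (Suc n) j"
  \<comment> \<open>For \<open>j = 0\<close> both sides vanish. For \<open>j = Suc i\<close> the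
    recurrence for \<open>Stirling\<close> calls on the induction hypothesis at both
    \<open>Suc i\<close> and \<open>i\<close>, hence the generalisation over
    \<open>j\<close>.\<close>
  proof (cases j)
    case 0
    then show ?thesis by simp
  next
    case (Suc i)
    have "(\<Sum>k\<le>n. (n choose k) * Stirling (Suc k) (Suc i))
        = Suc i * (\<Sum>k\<le>n. (n choose k) * Stirling k (Suc i)) + (\<Sum>k\<le>n. (n choose k) * Stirling k i)"
      by (simp only: Stirling.simps distrib_left sum.distrib sum_distrib_left mult.left_commute)
    then show ?thesis
      by (simp only: Suc Suc.IH)
  qed
  finally show ?case
    by simp
qed

lemma Suc_mult_Stirling_Suc:
  "Suc j * Stirling n (Suc j) = (\<Sum>k<n. (n choose k) * Stirling k j)"
  using Stirling_vertical_recurrence [of n j] by (simp add: lessThan_Suc_atMost [symmetric])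

text \<open>No bound on \<open>m\<close> is required: \<open>Stirling n m\<close> vanishes for
  \<open>m > n\<close>.\<close>

lemma coeff_geometric_poly: "coeff (geometric_poly n) m = of_nat (Stirling n m * fact m)"
proof -
  have "coeff (geometric_poly n :: 'a poly) m =
      (\<Sum>k\<le>n. if k = m then of_nat (Stirling n k * fact k) else 0)"
    unfolding geometric_poly_def coeff_sum by (intro sum.cong) auto
  then show ?thesis
    by (simp add: sum.delta Stirling_less)
qed

theorem proposition9:
  fixes n :: nat
  assumes "n \<ge> 1"
  shows "(geometric_poly n :: 'a :: comm_ring_1 poly) =
    [:0, 1:] * (\<Sum>k = 0..n - 1. of_nat (n choose k) * geometric_poly k)"
proof (rule poly_eqI)
  fix m
  \<comment> \<open>With truncated subtraction this would fail at \<open>n = 0\<close>.\<close>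
  have range: "{0..n - 1} = {..<n}"
    using assms by auto
  show "coeff (geometric_poly n :: 'a poly) m =
      coeff ([:0, 1:] * (\<Sum>k = 0..n - 1. of_nat (n choose k) * geometric_poly k)) m"
  proof (cases m)
    \<comment> \<open>The right side has the factor x, and \<open>Stirling n 0 = 0\<close> because
      \<open>n\<close> is positive.\<close>
    case 0
    with assms show ?thesis
      by (cases n) (simp_all add: coeff_geometric_poly)
  next
    case (Suc j)
    \<comment> \<open>The identity is proved over the naturals, so \<open>of_nat\<close> carries it
      to any commutative ring.\<close>
    have "Stirling n (Suc j) * fact (Suc j) = (Suc j * Stirling n (Suc j)) * fact j"
      by (simp add: algebra_simps)
    also have "\<dots> = (\<Sum>k<n. (n choose k) * (Stirling k j * fact j))"
      by (simp only: Suc_mult_Stirling_Suc sum_distrib_right mult.assoc)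
    finally show ?thesis
      by (simp only: Suc range coeff_geometric_poly)
        (simp add: of_nat_poly coeff_sum coeff_geometric_poly)
  qed
qed

end
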